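(* Fix $r\in\mathbb{N}$. Let $(X_k,Y_k)_{k=1}^r$ be i.i.d. with copula $$C_a^{\langle r\rangle}(x,y)=xy\left(1+a\,h_1(x^r)h_2(y^r)\right),\qquad (x,y)\in[0,1]^2.$$ Define $$U_1:=\left(\max_{1\le k\le r}X_k\right)^r,\qquad U_2:=\left(\max_{1\le k\le r}Y_k\right)^r.$$ Then $(U_1,U_2)$ has copula $$C_{a,r}(u_1,u_2)=u_1u_2\left(1+a\,h_1(u_1)h_2(u_2)\right)^r,\qquad (u_1,u_2)\in[0,1]^2.$$
   Context: Here $\mathbb{N}$ denotes the integers $r\ge 1$, $a\in\mathbb{R}$ is a fixed scalar, and $h_1,h_2:[0,1]\to\mathbb{R}$ are fixed kernel functions. A copula on $[0,1]^2$ is a bivariate distribution function with uniform univariate margins on $[0,1]$. A random pair with joint distribution function $H$ and univariate margins $F_1,F_2$ has copula $C$ if $H(x,y)=C(F_1(x),F_2(y))$ for all $x,y\in\mathbb{R}$; this copula is unique if the margins are continuous.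
   Formalization: For even r the variables X_k, Y_k are additionally assumed almost surely nonnegative (automatic for uniform margins on [0,1]); with arbitrary margins that can be negative, the claim is false for even r since x^r is not increasing. *)

theory Defs
  imports "HOL-Probability.Probability"
begin

definition joint_cdf :: "(real \<times> real) measure \<Rightarrow> real \<Rightarrow> real \<Rightarrow> real" where
  "joint_cdf N x y = measure N ({..x} \<times> {..y})"

text \<open>
  A copula is given by a total function of which only the values on the unit square matter;
  there it has to agree with the distribution function of a law on the plane both of whose
  marginals are uniform on the unit interval.
\<close>

definition is_copula :: "(real \<Rightarrow> real \<Rightarrow> real) \<Rightarrow> bool" where
  "is_copula C \<longleftrightarrow>
     (\<exists>N :: (real \<times> real) measure. prob_space N \<and> sets N = sets borel \<and>
        distr N borel fst = uniform_measure lborel {0..1} \<and>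
        distr N borel snd = uniform_measure lborel {0..1} \<and>
        (\<forall>x\<in>{0..1}. \<forall>y\<in>{0..1}. C x y = joint_cdf N x y))"

definition has_copula ::
    "'a measure \<Rightarrow> ('a \<Rightarrow> real) \<Rightarrow> ('a \<Rightarrow> real) \<Rightarrow> (real \<Rightarrow> real \<Rightarrow> real) \<Rightarrow> bool" where
  "has_copula M X Y C \<longleftrightarrow>
     X \<in> borel_measurable M \<and> Y \<in> borel_measurable M \<and> is_copula C \<and>
     (\<forall>x y. joint_cdf (distr M borel (\<lambda>\<omega>. (X \<omega>, Y \<omega>))) x y =
        C (cdf (distr M borel X) x) (cdf (distr M borel Y) y))"

definition copula_base ::
    "real \<Rightarrow> (real \<Rightarrow> real) \<Rightarrow> (real \<Rightarrow> real) \<Rightarrow> nat \<Rightarrow> real \<Rightarrow> real \<Rightarrow> real" where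
  "copula_base a h1 h2 r x y = x * y * (1 + a * h1 (x ^ r) * h2 (y ^ r))"

definition copula_max ::
    "real \<Rightarrow> (real \<Rightarrow> real) \<Rightarrow> (real \<Rightarrow> real) \<Rightarrow> nat \<Rightarrow> real \<Rightarrow> real \<Rightarrow> real" where
  "copula_max a h1 h2 r u v = u * v * (1 + a * h1 u * h2 v) ^ r"

end

theory Submission
  imports Defs
begin

text \<open>
  For odd exponents, or for nonnegative variables, \<open>x ^ r \<le> u\<close> means \<open>x \<le> root r u\<close>, so the event
  \<open>U1 \<le> u \<and> U2 \<le> v\<close> says that every sample point lies in the quadrant below
  \<open>(root r u, root r v)\<close>. By independence, the joint distribution function and both margins of
  \<open>(U1, U2)\<close> are \<open>r\<close>-th powers of those of \<open>(X, Y)\<close> at that point, and \<open>C(x, y) ^ r\<close> for the base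
  copula \<open>C\<close> depends on \<open>x ^ r\<close> and \<open>y ^ r\<close> only, in exactly the claimed way.
\<close>

text \<open>For \<open>n > 0\<close> the library's \<open>root n\<close> is strictly increasing on
  the whole real line, being extended to negative arguments as an odd function, so it may be applied
  to both sides even when \<open>u < 0\<close>. For even \<open>n\<close> it turns
  \<open>x ^ n\<close> into the absolute value of \<open>x\<close>, whence the sign
  condition.\<close>

lemma power_le_iff_le_root:
  fixes x u :: real
  assumes "n > 0" and "odd n \<or> x \<ge> 0"
  shows "x ^ n \<le> u \<longleftrightarrow> x \<le> root n u"
proof -
  have "root n (x ^ n) = x"
    using assms odd_real_root_power_cancel real_root_power_cancel by blast
  then show ?thesis
    using real_root_le_iff[OF assms(1), of "x ^ n" u] by simp
qed

lemma Max_power_le_iff: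
  fixes x :: "'i \<Rightarrow> real"
  assumes "finite I" "I \<noteq> {}" "n > 0" and "odd n \<or> (\<forall>k\<in>I. x k \<ge> 0)"
  shows "(MAX k\<in>I. x k) ^ n \<le> u \<longleftrightarrow> (\<forall>k\<in>I. x k \<le> root n u)"
proof -
  have "odd n \<or> (MAX k\<in>I. x k) \<ge> 0"
    using assms by (auto simp: Max_ge_iff)
  then show ?thesis
    using assms by (simp add: power_le_iff_le_root)
qed

lemma (in prob_space) prob_all_iid:
  assumes indep: "indep_vars (\<lambda>_. S) Z I" and "finite I" "I \<noteq> {}"
    and distr: "\<And>k. k \<in> I \<Longrightarrow> distr M S (Z k) = N"
    and B: "B \<in> sets S"
  shows "prob {\<omega>\<in>space M. \<forall>k\<in>I. Z k \<omega> \<in> B} = measure N B ^ card I"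
proof -
  have "{\<omega>\<in>space M. \<forall>k\<in>I. Z k \<omega> \<in> B} = (\<Inter>k\<in>I. Z k -` B \<inter> space M)"
    using \<open>I \<noteq> {}\<close> by auto
  also have "prob \<dots> = (\<Prod>k\<in>I. prob (Z k -` B \<inter> space M))"
    using assms by (intro indep_varsD_finite[OF indep]) auto
  also have "\<dots> = (\<Prod>k\<in>I. measure N B)"
  proof (rule prod.cong[OF refl])
    fix k assume "k \<in> I"
    then have "Z k \<in> M \<rightarrow>\<^sub>M S"
      using indep by (simp add: indep_vars_def)
    then show "prob (Z k -` B \<inter> space M) = measure N B"
      using B distr[OF \<open>k \<in> I\<close>] measure_distr by metis
  qed
  finally show ?thesis by simp
qed

text \<open>Independence amounts to the joint law being the product of the component laws, which the
  identity map on a product space satisfies. The spaces \<open>S i\<close> are kept apart from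
  \<open>N i\<close> so that coordinates can count as \<open>borel\<close> variables.\<close>

lemma indep_vars_PiM_components:
  assumes "I \<noteq> {}" and "\<And>i. i \<in> I \<Longrightarrow> prob_space (N i)"
    and sets: "\<And>i. i \<in> I \<Longrightarrow> sets (N i) = sets (S i)"
  shows "prob_space.indep_vars (PiM I N) S (\<lambda>i \<omega>. \<omega> i) I"
proof -
  interpret P: prob_space "PiM I N"
    using assms by (intro prob_space_PiM)
  have S: "sets (PiM I N) = sets (PiM I S)"
    using sets by (intro sets_PiM_cong) auto
  have rv: "P.random_variable (S i) (\<lambda>\<omega>. \<omega> i)" if "i \<in> I" for i
    using measurable_component_singleton[OF that, of N] sets[OF that]
      measurable_cong_sets[OF refl sets[OF that]] by blast
  \<comment> \<open>Points of a product space are extensional, so restricting them to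
    \<open>I\<close> changes nothing.\<close>
  have "distr (PiM I N) (PiM I S) (\<lambda>\<omega>. \<lambda>i\<in>I. \<omega> i) = distr (PiM I N) (PiM I N) (\<lambda>\<omega>. \<omega>)"
    using S by (intro distr_cong) (auto simp: space_PiM PiE_def extensional_restrict)
  also have "\<dots> = PiM I N" by simp
  also have "\<dots> = PiM I (\<lambda>i. distr (PiM I N) (S i) (\<lambda>\<omega>. \<omega> i))"
  proof (rule PiM_cong[OF refl])
    fix i assume "i \<in> I"
    then have "distr (PiM I N) (S i) (\<lambda>\<omega>. \<omega> i) = distr (PiM I N) (N i) (\<lambda>\<omega>. \<omega> i)"
      using sets by (intro distr_cong) auto
    then show "N i = distr (PiM I N) (S i) (\<lambda>\<omega>. \<omega> i)"
      using assms \<open>i \<in> I\<close> by (simp add: distr_PiM_component)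
  qed
  finally show ?thesis
    using assms(1) rv by (subst P.indep_vars_iff_distr_eq_PiM') auto
qed

lemma joint_cdf_distr:
  assumes [measurable]: "U \<in> borel_measurable M" "V \<in> borel_measurable M"
  shows "joint_cdf (distr M borel (\<lambda>\<omega>. (U \<omega>, V \<omega>))) u v =
    measure M {\<omega>\<in>space M. U \<omega> \<le> u \<and> V \<omega> \<le> v}"
  unfolding joint_cdf_def
  by (subst measure_distr) (auto simp flip: borel_prod intro!: arg_cong[where f = "measure M"])

lemma cdf_distr:
  assumes [measurable]: "U \<in> borel_measurable M"
  shows "cdf (distr M borel U) u = measure M {\<omega>\<in>space M. U \<omega> \<le> u}"
  unfolding cdf_def by (subst measure_distr) (auto intro!: arg_cong[where f = "measure M"])

lemma distr_Pair_margins: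
  fixes U V :: "'a \<Rightarrow> real"
  assumes [measurable]: "U \<in> borel_measurable M" "V \<in> borel_measurable M"
  shows "distr (distr M borel (\<lambda>\<omega>. (U \<omega>, V \<omega>))) borel fst = distr M borel U"
    and "distr (distr M borel (\<lambda>\<omega>. (U \<omega>, V \<omega>))) borel snd = distr M borel V"
  by (simp_all add: distr_distr comp_def flip: borel_prod)

text \<open>Stated for an arbitrary common law \<open>N\<close>, since it serves twice: for the
  given sample, and for the canonical sample that shows \<open>copula_max\<close> to be a
  copula.\<close>

lemma (in prob_space) iid_Max_power_cdf:
  fixes X Y :: "'i \<Rightarrow> 'a \<Rightarrow> real"
  assumes I: "finite I" "I \<noteq> {}" and n: "n > 0"
    and indep: "indep_vars (\<lambda>_. borel) (\<lambda>k \<omega>. (X k \<omega>, Y k \<omega>)) I"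
    and distr: "\<And>k. k \<in> I \<Longrightarrow> distr M borel (\<lambda>\<omega>. (X k \<omega>, Y k \<omega>)) = N"
    and nonneg: "\<And>k. even n \<Longrightarrow> k \<in> I \<Longrightarrow> AE \<omega> in M. X k \<omega> \<ge> 0 \<and> Y k \<omega> \<ge> 0"
  defines "U \<equiv> \<lambda>\<omega>. (MAX k\<in>I. X k \<omega>) ^ n"
    and "V \<equiv> \<lambda>\<omega>. (MAX k\<in>I. Y k \<omega>) ^ n"
  shows "U \<in> borel_measurable M" and "V \<in> borel_measurable M"
    and "joint_cdf (distr M borel (\<lambda>\<omega>. (U \<omega>, V \<omega>))) u v =
      joint_cdf N (root n u) (root n v) ^ card I"
    and "cdf (distr M borel U) u = cdf (distr N borel fst) (root n u) ^ card I"
    and "cdf (distr M borel V) v = cdf (distr N borel snd) (root n v) ^ card I"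
proof -
  have rv: "(\<lambda>\<omega>. (X k \<omega>, Y k \<omega>)) \<in> M \<rightarrow>\<^sub>M borel \<Otimes>\<^sub>M borel" if "k \<in> I" for k
    using indep that by (simp add: indep_vars_def borel_prod)
  have rvX: "X k \<in> borel_measurable M" and rvY: "Y k \<in> borel_measurable M" if "k \<in> I" for k
    using measurable_compose[OF rv[OF that] measurable_fst]
      measurable_compose[OF rv[OF that] measurable_snd] by simp_all
  show U [measurable]: "U \<in> borel_measurable M" and V [measurable]: "V \<in> borel_measurable M"
    unfolding U_def V_def using I rvX rvY
    by (auto intro!: borel_measurable_power borel_measurable_Max)
  have AE_pos: "AE \<omega> in M. odd n \<or> (\<forall>k\<in>I. X k \<omega> \<ge> 0 \<and> Y k \<omega> \<ge> 0)"
    using nonneg I by (cases "odd n") (auto intro!: AE_finite_allI)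
  \<comment> \<open>The exceptional null set comes from negative values alone, so one null set
    serves all thresholds.\<close>
  have AE_U: "AE \<omega> in M. \<forall>u. U \<omega> \<le> u \<longleftrightarrow> (\<forall>k\<in>I. X k \<omega> \<le> root n u)"
    and AE_V: "AE \<omega> in M. \<forall>v. V \<omega> \<le> v \<longleftrightarrow> (\<forall>k\<in>I. Y k \<omega> \<le> root n v)"
    unfolding U_def V_def using AE_pos
    by (eventually_elim, intro allI Max_power_le_iff I n, blast)+
  have sets_N: "sets N = sets borel"
    using distr I by (metis all_not_in_conv sets_distr)
  have rect: "A \<times> B \<in> sets (borel :: (real \<times> real) measure)"
    if "A \<in> sets borel" "B \<in> sets borel" for A B :: "real set"
    unfolding borel_prod[symmetric] using that by (rule pair_measureI)
  have meas: "{\<omega>\<in>space M. \<forall>k\<in>I. (X k \<omega>, Y k \<omega>) \<in> B} \<in> events"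
    if "B \<in> sets borel" for B
    using I rv that by (intro sets.sets_Collect_finite_All) (auto simp: borel_prod)
  \<comment> \<open>All three distribution functions are instances: two half-lines give the joint
    one, and replacing one of them by \<open>UNIV\<close> gives a margin. The event \<open>E\<close>
    may differ from the sample event by a null set.\<close>
  have iid: "prob E = measure N (A \<times> B) ^ card I"
    if "A \<in> sets borel" "B \<in> sets borel" "E \<in> events"
      and "AE \<omega> in M. \<omega> \<in> E \<longleftrightarrow> (\<forall>k\<in>I. X k \<omega> \<in> A \<and> Y k \<omega> \<in> B)" for A B E
  proof -
    have "prob E = prob {\<omega>\<in>space M. \<forall>k\<in>I. (X k \<omega>, Y k \<omega>) \<in> A \<times> B}"
      using that meas[OF rect] by (intro measure_eq_AE) auto
    also have "\<dots> = measure N (A \<times> B) ^ card I"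
      using that by (intro prob_all_iid[OF indep I distr] rect) auto
    finally show ?thesis .
  qed
  show "joint_cdf (distr M borel (\<lambda>\<omega>. (U \<omega>, V \<omega>))) u v =
      joint_cdf N (root n u) (root n v) ^ card I"
    unfolding joint_cdf_distr[OF U V] unfolding joint_cdf_def
    by (rule iid) (use AE_U AE_V in auto)
  have fst_snd: "cdf (distr N borel fst) s = measure N ({..s} \<times> UNIV)"
    "cdf (distr N borel snd) s = measure N (UNIV \<times> {..s})" for s
  proof -
    have "fst \<in> borel_measurable N" "snd \<in> borel_measurable N"
      unfolding measurable_cong_sets[OF sets_N refl] borel_prod[symmetric] by measurable
    moreover have "space N = UNIV"
      using sets_eq_imp_space_eq[OF sets_N] by simp
    ultimately show "cdf (distr N borel fst) s = measure N ({..s} \<times> UNIV)"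
      "cdf (distr N borel snd) s = measure N (UNIV \<times> {..s})"
      by (simp_all add: cdf_def measure_distr fst_vimage_eq_Times snd_vimage_eq_Times)
  qed
  show "cdf (distr M borel U) u = cdf (distr N borel fst) (root n u) ^ card I"
    unfolding cdf_distr[OF U] fst_snd
    by (rule iid) (use AE_U in auto)
  show "cdf (distr M borel V) v = cdf (distr N borel snd) (root n v) ^ card I"
    unfolding cdf_distr[OF V] fst_snd
    by (rule iid) (use AE_V in auto)
qed

lemma cdf_uniform_unit_interval:
  "cdf (uniform_measure lborel {0..1}) x = min (max 0 x) (1::real)"
proof -
  have "{0..1} \<inter> {..x} = {0..min 1 x}" by auto
  then show ?thesis
    by (auto simp: cdf_def min.commute)
qed

lemma prob_space_uniform_unit_interval:
  "prob_space (uniform_measure lborel {0..1::real})"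
  by (intro prob_space_uniform_measure) auto

lemma AE_uniform_unit_interval_nonneg:
  "AE x in uniform_measure lborel {0..1::real}. x \<ge> 0"
  by (intro AE_uniform_measureI) auto

text \<open>\<open>root n\<close> preserves each of the regions below 0, between 0 and 1, and above
  1. Hence the \<open>n\<close>-th power of the maximum of \<open>n\<close> independent uniform
  variables is again uniform.\<close>

lemma min_max_root_power:
  fixes u :: real
  assumes "n > 0"
  shows "min (max 0 (root n u)) 1 ^ n = min (max 0 u) 1"
proof -
  consider "u < 0" | "0 \<le> u" "u \<le> 1" | "1 < u" by linarith
  then show ?thesis
    using assms by cases (auto simp: min_def max_def)
qed

text \<open>When \<open>x\<close> and \<open>y\<close> are marginal distribution functions of one
  observation, \<open>x ^ n\<close> and \<open>y ^ n\<close> are those of the maxima of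
  \<open>n\<close> observations, so the right-hand side is already in copula form.\<close>

lemma copula_base_power:
  "copula_base a h1 h2 n x y ^ n = copula_max a h1 h2 n (x ^ n) (y ^ n)"
  by (simp add: copula_base_def copula_max_def power_mult_distrib)

text \<open>
  The witness is the law of the maximum pair of an i.i.d. sample from the law of the base copula
  itself; the given variables cannot serve, because their margins need not be continuous.
\<close>

lemma is_copula_copula_max:
  assumes n: "n > 0" and C: "is_copula (copula_base a h1 h2 n)"
  shows "is_copula (copula_max a h1 h2 n)"
proof -
  from C obtain N :: "(real \<times> real) measure" where N: "prob_space N" and sets_N: "sets N = sets borel"
    and fst_N: "distr N borel fst = uniform_measure lborel {0..1}"
    and snd_N: "distr N borel snd = uniform_measure lborel {0..1}"
    and C_N: "\<And>x y. x \<in> {0..1} \<Longrightarrow> y \<in> {0..1} \<Longrightarrow> copula_base a h1 h2 n x y = joint_cdf N x y"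
    unfolding is_copula_def by blast
  interpret N: prob_space N by (rule N)
  define I where "I = {1..n}"
  have I: "finite I" "I \<noteq> {}" "card I = n"
    using n by (auto simp: I_def)
  define P where "P = PiM I (\<lambda>_. N)"
  interpret P: prob_space P
    unfolding P_def by (intro prob_space_PiM N)
  define X where "X k \<omega> = fst (\<omega> k)" for k :: nat and \<omega> :: "nat \<Rightarrow> real \<times> real"
  define Y where "Y k \<omega> = snd (\<omega> k)" for k :: nat and \<omega> :: "nat \<Rightarrow> real \<times> real"
  define U where "U \<omega> = (MAX k\<in>I. X k \<omega>) ^ n" for \<omega>
  define V where "V \<omega> = (MAX k\<in>I. Y k \<omega>) ^ n" for \<omega>
  have indep: "P.indep_vars (\<lambda>_. borel) (\<lambda>k \<omega>. (X k \<omega>, Y k \<omega>)) I"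
    unfolding P_def X_def Y_def prod.collapse
    using I N sets_N by (intro indep_vars_PiM_components) auto
  have distr: "distr P borel (\<lambda>\<omega>. (X k \<omega>, Y k \<omega>)) = N" if "k \<in> I" for k
  proof -
    have "distr P borel (\<lambda>\<omega>. \<omega> k) = distr P N (\<lambda>\<omega>. \<omega> k)"
      using sets_N by (intro distr_cong) auto
    then show ?thesis
      using distr_PiM_component[of I "\<lambda>_. N" k] that I N unfolding P_def X_def Y_def prod.collapse by simp
  qed
  have [measurable]: "fst \<in> borel_measurable N" "snd \<in> borel_measurable N"
    unfolding measurable_cong_sets[OF sets_N refl] borel_prod[symmetric] by measurable
  \<comment> \<open>The uniform margins of \<open>N\<close> supply the sign condition for the
    canonical sample.\<close>
  have pos: "AE z in N. fst z \<ge> 0 \<and> snd z \<ge> 0"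
  proof (rule AE_conjI)
    show "AE z in N. fst z \<ge> 0"
      by (rule AE_distrD[of fst N borel, unfolded fst_N, OF _ AE_uniform_unit_interval_nonneg]) simp
    show "AE z in N. snd z \<ge> 0"
      by (rule AE_distrD[of snd N borel, unfolded snd_N, OF _ AE_uniform_unit_interval_nonneg]) simp
  qed
  have nonneg: "AE \<omega> in P. X k \<omega> \<ge> 0 \<and> Y k \<omega> \<ge> 0"
    if "even n" "k \<in> I" for k
    unfolding P_def X_def Y_def by (rule AE_PiM_component[OF N that(2) pos])
  note max = P.iid_Max_power_cdf[OF I(1,2) n indep distr nonneg, folded U_def V_def]
  have [measurable]: "U \<in> borel_measurable P" "V \<in> borel_measurable P"
    using max(1,2) by blast+
  \<comment> \<open>A law on the line is determined by its distribution function.\<close>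
  have unif: "W = uniform_measure lborel {0..1}"
    if "real_distribution W" and W: "\<And>u. cdf W u = min (max 0 u) 1" for W :: "real measure"
  proof (rule cdf_unique[OF that(1)])
    show "real_distribution (uniform_measure lborel {0..1})"
      using prob_space_uniform_unit_interval
      by (simp add: real_distribution_def real_distribution_axioms_def)
    show "cdf W = cdf (uniform_measure lborel {0..1})"
      using W by (auto simp: cdf_uniform_unit_interval)
  qed
  let ?Q = "distr P borel (\<lambda>\<omega>. (U \<omega>, V \<omega>))"
  have UV: "(\<lambda>\<omega>. (U \<omega>, V \<omega>)) \<in> borel_measurable P"
    unfolding borel_prod[symmetric] by measurable
  show ?thesis
    unfolding is_copula_def
  proof (intro exI[of _ ?Q] conjI ballI)
    show "prob_space ?Q"
      using UV by (rule P.prob_space_distr)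
    show "sets ?Q = sets borel" by simp
    have "distr P borel U = uniform_measure lborel {0..1}"
      "distr P borel V = uniform_measure lborel {0..1}"
      using max(4,5) I(3) n
      by (auto intro!: unif simp: fst_N snd_N cdf_uniform_unit_interval min_max_root_power)
    then show "distr ?Q borel fst = uniform_measure lborel {0..1}"
      "distr ?Q borel snd = uniform_measure lborel {0..1}" by (simp_all add: distr_Pair_margins)
    fix u v :: real assume uv: "u \<in> {0..1}" "v \<in> {0..1}"
    \<comment> \<open>Roots of points of the unit interval stay in it, where \<open>C_N\<close>
      applies.\<close>
    then have "copula_base a h1 h2 n (root n u) (root n v) = joint_cdf N (root n u) (root n v)"
      using n by (intro C_N) auto
    then show "copula_max a h1 h2 n u v = joint_cdf ?Q u v"
      using uv n max(3)[of u v] I(3) copula_base_power[of a h1 h2 n "root n u" "root n v"] by simp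
  qed
qed

text \<open>The sample may have any margins, since \<open>has_copula\<close> fixes only how they are
  coupled. An even power is not monotone on negative values, so \<open>nonneg\<close> is imposed
  exactly for even \<open>r\<close>.\<close>

theorem theorem5:
  fixes M :: "'a measure"
    and X Y :: "nat \<Rightarrow> 'a \<Rightarrow> real"
    and a :: real
    and h1 h2 :: "real \<Rightarrow> real"
    and r :: nat
  assumes "prob_space M"
    and "r \<ge> 1"
    and indep: "prob_space.indep_vars M (\<lambda>_. borel) (\<lambda>k \<omega>. (X k \<omega>, Y k \<omega>)) {1..r}"
    and ident: "\<And>k l. k \<in> {1..r} \<Longrightarrow> l \<in> {1..r} \<Longrightarrow>
      distr M borel (\<lambda>\<omega>. (X k \<omega>, Y k \<omega>)) = distr M borel (\<lambda>\<omega>. (X l \<omega>, Y l \<omega>))"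
    and copula: "\<And>k. k \<in> {1..r} \<Longrightarrow> has_copula M (X k) (Y k) (copula_base a h1 h2 r)"
    and nonneg: "\<And>k. even r \<Longrightarrow> k \<in> {1..r} \<Longrightarrow> AE \<omega> in M. X k \<omega> \<ge> 0 \<and> Y k \<omega> \<ge> 0"
  shows "has_copula M (\<lambda>\<omega>. (MAX k\<in>{1..r}. X k \<omega>) ^ r) (\<lambda>\<omega>. (MAX k\<in>{1..r}. Y k \<omega>) ^ r)
           (copula_max a h1 h2 r)"
proof -
  interpret prob_space M by fact
  have r: "r > 0" "finite {1..r}" "{1..r} \<noteq> {}" "card {1..r} = r" "1 \<in> {1..r}"
    using \<open>r \<ge> 1\<close> by auto
  let ?N = "distr M borel (\<lambda>\<omega>. (X 1 \<omega>, Y 1 \<omega>))"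
  let ?F = "cdf (distr M borel (X 1))" and ?G = "cdf (distr M borel (Y 1))"
  have [measurable]: "X 1 \<in> borel_measurable M" "Y 1 \<in> borel_measurable M"
    and C: "is_copula (copula_base a h1 h2 r)"
    and H: "joint_cdf ?N x y = copula_base a h1 h2 r (?F x) (?G y)" for x y
    using copula[OF r(5)] by (simp_all add: has_copula_def)
  have margins: "distr ?N borel fst = distr M borel (X 1)" "distr ?N borel snd = distr M borel (Y 1)"
    by (rule distr_Pair_margins; measurable)+
  \<comment> \<open>The joint distribution function becomes the \<open>r\<close>-th power of
    \<open>copula_base\<close> at \<open>?F (root r u)\<close> and \<open>?G (root r v)\<close>,
    while the margins become the \<open>r\<close>-th powers of these two values;
    \<open>copula_base_power\<close> matches the two.\<close>
  note max = iid_Max_power_cdf[OF r(2,3,1) indep ident[OF _ r(5)] nonneg, unfolded r(4) margins H]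
  show ?thesis
    unfolding has_copula_def
    using max is_copula_copula_max[OF r(1) C] by (simp add: copula_base_power)
qed

end
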